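(* Let $F$ be a field with $\mathrm{char}(F)\neq 2$ and let $L$ be a Lie algebra over $F$ that is perfect (i.e. $[L,L]=L$) and centerless (i.e. its center is $\{0\}$); in particular, $L$ may be any simple Lie algebra. Then for every skew-symmetric biderivation $\delta$ on $L$ there exists $\gamma\in\mathrm{Cent}(L)$ such that $\delta(x,y)=\gamma([x,y])$ for all $x,y\in L$.
   Context: $L$ is not assumed finite dimensional. A skew-symmetric biderivation on $L$ is an $F$-bilinear map $\delta:L\times L\to L$ such that $\delta(x,y)=-\delta(y,x)$ for all $x,y\in L$ and $\delta([x,y],z)=[x,\delta(y,z)]-[y,\delta(x,z)]$ for all $x,y,z\in L$. The centroid $\mathrm{Cent}(L)$ is the space of all $F$-linear maps $\gamma:L\to L$ with $\gamma([x,y])=[x,\gamma(y)]$ for all $x,y\in L$. *)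

theory Defs
  imports "HOL-Computational_Algebra.Computational_Algebra"
begin

text \<open>
  Lie algebras over a field, of arbitrary dimension. The underlying set is the whole type
  \<open>'b\<close>; bilinear maps are maps that are linear in each argument separately.
\<close>

definition bilinear_map ::
  "('a::field \<Rightarrow> 'b::ab_group_add \<Rightarrow> 'b) \<Rightarrow> ('b \<Rightarrow> 'b \<Rightarrow> 'b) \<Rightarrow> bool" where
  "bilinear_map scale f \<longleftrightarrow>
     (\<forall>x. Vector_Spaces.linear scale scale (\<lambda>y. f x y)) \<and>
     (\<forall>y. Vector_Spaces.linear scale scale (\<lambda>x. f x y))"

locale lie_algebra = vector_space scale
  for scale :: "'a::field \<Rightarrow> 'b::ab_group_add \<Rightarrow> 'b" (infixr \<open>*s\<close> 75) +
  fixes bracket :: "'b \<Rightarrow> 'b \<Rightarrow> 'b" (\<open>\<lbrakk>_,/ _\<rbrakk>\<close>)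
  assumes bilinear_bracket: "bilinear_map scale bracket"
    and alternating: "\<lbrakk>x, x\<rbrakk> = 0"
    and jacobi: "\<lbrakk>x, \<lbrakk>y, z\<rbrakk>\<rbrakk> + \<lbrakk>y, \<lbrakk>z, x\<rbrakk>\<rbrakk> + \<lbrakk>z, \<lbrakk>x, y\<rbrakk>\<rbrakk> = 0"
begin

definition derived_algebra :: "'b set" where
  "derived_algebra = span {\<lbrakk>x, y\<rbrakk> | x y. True}"

definition center :: "'b set" where
  "center = {z. \<forall>x. \<lbrakk>z, x\<rbrakk> = 0}"

definition perfect :: bool where
  "perfect \<longleftrightarrow> derived_algebra = UNIV"

definition centerless :: bool where
  "centerless \<longleftrightarrow> center = {0}"

text \<open>One-sided ideals are two-sided, by anticommutativity of the bracket.\<close>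

definition lie_ideal :: "'b set \<Rightarrow> bool" where
  "lie_ideal I \<longleftrightarrow> subspace I \<and> (\<forall>x. \<forall>y\<in>I. \<lbrakk>x, y\<rbrakk> \<in> I)"

definition simple :: bool where
  "simple \<longleftrightarrow> (\<exists>x y. \<lbrakk>x, y\<rbrakk> \<noteq> 0) \<and> (\<forall>I. lie_ideal I \<longrightarrow> I = {0} \<or> I = UNIV)"

definition skew_biderivation :: "('b \<Rightarrow> 'b \<Rightarrow> 'b) \<Rightarrow> bool" where
  "skew_biderivation \<delta> \<longleftrightarrow>
     bilinear_map scale \<delta> \<and>
     (\<forall>x y. \<delta> x y = - \<delta> y x) \<and>
     (\<forall>x y z. \<delta> \<lbrakk>x, y\<rbrakk> z = \<lbrakk>x, \<delta> y z\<rbrakk> - \<lbrakk>y, \<delta> x z\<rbrakk>)"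

definition centroid :: "('b \<Rightarrow> 'b) set" where
  "centroid = {\<gamma>. Vector_Spaces.linear scale scale \<gamma> \<and> (\<forall>x y. \<gamma> \<lbrakk>x, y\<rbrakk> = \<lbrakk>x, \<gamma> y\<rbrakk>)}"

end

end

theory Submission
  imports Defs
begin

text \<open>
  Expanding \<open>\<delta>([x,u],[y,v])\<close> in both orders shows that
  \<open>[\<delta>(x,y),[u,v]] - [[x,y],\<delta>(u,v)]\<close> is symmetric under exchanging \<open>x\<close> and \<open>u\<close>. As it is
  skew under exchanging \<open>x\<close> and \<open>y\<close>, and these transpositions are conjugate, it vanishes. In a
  perfect centerless algebra this identity makes \<open>\<gamma>([x,y]) = \<delta>(x,y)\<close> a well-defined linear map,
  which moreover satisfies \<open>[\<gamma>(x),y] = [x,\<gamma>(y)]\<close>.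

  The defect \<open>f(x,y) = \<delta>(x,y) - [x,\<gamma>(y)]\<close> is again a skew-symmetric biderivation, and
  \<open>[x,f(y,z)]\<close> is invariant under cyclic permutations. These properties force
  \<open>f([x,y],[z,w])\<close> to be totally skew-symmetric, hence invariant under the even permutation that
  exchanges the two pairs, whereas skew-symmetry of \<open>f\<close> makes it change sign. So it is zero, and
  \<open>f = 0\<close> by perfectness.
\<close>

lemma (in vector_space) eq_neg_self_imp_zero:
  fixes x :: 'b
  assumes "CHAR('a) \<noteq> 2" and "x = - x"
  shows "x = 0"
proof -
  have "(2::'a) \<noteq> 0"
  proof
    assume "(2::'a) = 0"
    then have "of_nat 2 = (0::'a)" by simp
    then have "CHAR('a) dvd 2" using of_nat_eq_0_iff_char_dvd by blast
    then have "CHAR('a) = 1 \<or> CHAR('a) = 2"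
      using two_is_prime_nat prime_nat_iff[of 2] by metis
    then show False using assms(1) CHAR_not_1 by auto
  qed
  moreover have "scale 2 x = 0"
  proof -
    have "scale 2 x = scale (1 + 1) x" by simp
    also have "\<dots> = x + x" by (simp only: scale_left_distrib scale_one)
    also have "\<dots> = 0" using assms(2) by (simp only: eq_neg_iff_add_eq_0)
    finally show ?thesis .
  qed
  ultimately show ?thesis by simp
qed

context lie_algebra
begin

section \<open>Bilinear maps, the bracket, and perfect algebras\<close>

lemma bilinear_mapD:
  assumes "bilinear_map scale f"
  shows "f (x + y) z = f x z + f y z" "f z (x + y) = f z x + f z y"
    and "f (c *s x) y = c *s f x y" "f x (c *s y) = c *s f x y"
    and "f (x - y) z = f x z - f y z" "f z (x - y) = f z x - f z y"
    and "f (- x) y = - f x y" "f x (- y) = - f x y"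
    and "f 0 x = 0" "f x 0 = 0"
proof -
  interpret l: Vector_Spaces.linear scale scale "\<lambda>x. f x b" for b
    using assms by (simp add: bilinear_map_def)
  interpret r: Vector_Spaces.linear scale scale "\<lambda>y. f a y" for a
    using assms by (simp add: bilinear_map_def)
  show "f (x + y) z = f x z + f y z" "f z (x + y) = f z x + f z y"
    "f (c *s x) y = c *s f x y" "f x (c *s y) = c *s f x y"
    "f (x - y) z = f x z - f y z" "f z (x - y) = f z x - f z y"
    "f (- x) y = - f x y" "f x (- y) = - f x y" "f 0 x = 0" "f x 0 = 0"
    by (fact l.add r.add l.scale r.scale l.diff r.diff l.neg r.neg l.zero r.zero)+
qed

lemmas bracket_linear = bilinear_mapD[OF bilinear_bracket]

lemma bracket_skew: "\<lbrakk>x, y\<rbrakk> = - \<lbrakk>y, x\<rbrakk>"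
proof -
  have "\<lbrakk>x, y\<rbrakk> + \<lbrakk>y, x\<rbrakk> = \<lbrakk>x + y, x + y\<rbrakk> - \<lbrakk>x, x\<rbrakk> - \<lbrakk>y, y\<rbrakk>"
    by (simp add: bracket_linear(1,2))
  then have "\<lbrakk>x, y\<rbrakk> + \<lbrakk>y, x\<rbrakk> = 0" by (simp add: alternating)
  then show ?thesis by (simp add: eq_neg_iff_add_eq_0)
qed

lemma bracket_derivation: "\<lbrakk>x, \<lbrakk>y, z\<rbrakk>\<rbrakk> = \<lbrakk>\<lbrakk>x, y\<rbrakk>, z\<rbrakk> + \<lbrakk>y, \<lbrakk>x, z\<rbrakk>\<rbrakk>"
proof -
  have "\<lbrakk>y, \<lbrakk>z, x\<rbrakk>\<rbrakk> = - \<lbrakk>y, \<lbrakk>x, z\<rbrakk>\<rbrakk>"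
    by (metis bracket_skew bracket_linear(8))
  moreover have "\<lbrakk>z, \<lbrakk>x, y\<rbrakk>\<rbrakk> = - \<lbrakk>\<lbrakk>x, y\<rbrakk>, z\<rbrakk>" by (rule bracket_skew)
  ultimately show ?thesis using jacobi[of x y z] by (simp add: algebra_simps)
qed

lemma linearI:
  assumes "\<And>x y. f (x + y) = f x + f y" and "\<And>c x. f (c *s x) = c *s f x"
  shows "Vector_Spaces.linear scale scale f"
  by unfold_locales (use assms in \<open>auto simp: scale_right_distrib scale_left_distrib\<close>)

lemma perfect_induct [consumes 1, case_names bracket add scale]:
  assumes "perfect"
    and "\<And>x y. P \<lbrakk>x, y\<rbrakk>"
    and add: "\<And>x y. P x \<Longrightarrow> P y \<Longrightarrow> P (x + y)"
    and scale: "\<And>c x. P x \<Longrightarrow> P (c *s x)"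
  shows "P z"
proof (rule span_induct[where S = "{\<lbrakk>x, y\<rbrakk> | x y. True}"])
  show "z \<in> span {\<lbrakk>x, y\<rbrakk> | x y. True}"
    using assms(1) by (simp add: perfect_def derived_algebra_def)
  \<comment> \<open>No case for zero is demanded of the user: zero is a bracket scaled by 0.\<close>
  have "P 0" using scale[OF assms(2), of 0] by simp
  then show "subspace {x. P x}" using add scale by (simp add: subspace_def)
qed (use assms(2) in auto)

text \<open>As brackets span, w - w' commutes with everything and is therefore central. This is the
  uniqueness principle behind the construction of \<gamma>.\<close>

lemma perfect_centerless_eqI:
  assumes "perfect" "centerless" and "\<And>u v. \<lbrakk>w, \<lbrakk>u, v\<rbrakk>\<rbrakk> = \<lbrakk>w', \<lbrakk>u, v\<rbrakk>\<rbrakk>"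
  shows "w = w'"
proof -
  have "\<lbrakk>w, x\<rbrakk> = \<lbrakk>w', x\<rbrakk>" for x
    using assms(1) by (induction x rule: perfect_induct) (simp_all add: assms(3) bracket_linear)
  then have "w - w' \<in> center" by (simp add: center_def bracket_linear)
  then show ?thesis using assms(2) by (simp add: centerless_def)
qed

section \<open>Skew-symmetric biderivations\<close>

lemma skew_biderivation_bilinear: "skew_biderivation \<delta> \<Longrightarrow> bilinear_map scale \<delta>"
  and skew_biderivation_skew: "skew_biderivation \<delta> \<Longrightarrow> \<delta> x y = - \<delta> y x"
  and skew_biderivation_left:
    "skew_biderivation \<delta> \<Longrightarrow> \<delta> \<lbrakk>x, y\<rbrakk> z = \<lbrakk>x, \<delta> y z\<rbrakk> - \<lbrakk>y, \<delta> x z\<rbrakk>"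
  unfolding skew_biderivation_def by blast+

lemma skew_biderivation_right:
  assumes "skew_biderivation \<delta>"
  shows "\<delta> x \<lbrakk>y, z\<rbrakk> = \<lbrakk>y, \<delta> x z\<rbrakk> - \<lbrakk>z, \<delta> x y\<rbrakk>"
proof -
  have "\<delta> x \<lbrakk>y, z\<rbrakk> = - (\<lbrakk>y, \<delta> z x\<rbrakk> - \<lbrakk>z, \<delta> y x\<rbrakk>)"
    using skew_biderivation_skew[OF assms, of x "\<lbrakk>y, z\<rbrakk>"]
    by (simp only: skew_biderivation_left[OF assms])
  also have "\<dots> = \<lbrakk>y, - \<delta> z x\<rbrakk> - \<lbrakk>z, - \<delta> y x\<rbrakk>" by (simp add: bracket_linear)
  also have "\<dots> = \<lbrakk>y, \<delta> x z\<rbrakk> - \<lbrakk>z, \<delta> x y\<rbrakk>"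
    using skew_biderivation_skew[OF assms, of x z] skew_biderivation_skew[OF assms, of x y]
    by simp
  finally show ?thesis .
qed

lemma skew_biderivation_bracket_swap:
  assumes "CHAR('a) \<noteq> 2" and \<delta>: "skew_biderivation \<delta>"
  shows "\<lbrakk>\<delta> x y, \<lbrakk>u, v\<rbrakk>\<rbrakk> = \<lbrakk>\<lbrakk>x, y\<rbrakk>, \<delta> u v\<rbrakk>"
proof -
  define \<phi> where "\<phi> x y u v = \<lbrakk>\<delta> x y, \<lbrakk>u, v\<rbrakk>\<rbrakk> - \<lbrakk>\<lbrakk>x, y\<rbrakk>, \<delta> u v\<rbrakk>" for x y u v
  have skew12: "\<phi> x y u v = - \<phi> y x u v" for x y u v
    unfolding \<phi>_def bracket_skew[of x y] skew_biderivation_skew[OF \<delta>, of x y]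
    by (simp add: bracket_linear)
  have sym13: "\<phi> x y u v = \<phi> u y x v" for x y u v
  proof -
    \<comment> \<open>\<open>?P\<close> expands the left argument first, \<open>?Q\<close> the right
      one. In their difference the nested brackets pair up, and the Jacobi identity merges each pair
      into a bracket with [x,y], [u,v], [u,y] or [x,v].\<close>
    let ?P = "\<lbrakk>x, \<lbrakk>y, \<delta> u v\<rbrakk>\<rbrakk> - \<lbrakk>x, \<lbrakk>v, \<delta> u y\<rbrakk>\<rbrakk> - (\<lbrakk>u, \<lbrakk>y, \<delta> x v\<rbrakk>\<rbrakk> - \<lbrakk>u, \<lbrakk>v, \<delta> x y\<rbrakk>\<rbrakk>)"
    let ?Q = "\<lbrakk>y, \<lbrakk>x, \<delta> u v\<rbrakk>\<rbrakk> - \<lbrakk>y, \<lbrakk>u, \<delta> x v\<rbrakk>\<rbrakk> - (\<lbrakk>v, \<lbrakk>x, \<delta> u y\<rbrakk>\<rbrakk> - \<lbrakk>v, \<lbrakk>u, \<delta> x y\<rbrakk>\<rbrakk>)"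
    have "\<delta> \<lbrakk>x, u\<rbrakk> \<lbrakk>y, v\<rbrakk> = ?P"
      by (simp only: skew_biderivation_left[OF \<delta>, of x u "\<lbrakk>y, v\<rbrakk>"]
        skew_biderivation_right[OF \<delta>, of x y v] skew_biderivation_right[OF \<delta>, of u y v]
        bracket_linear(6))
    moreover have "\<delta> \<lbrakk>x, u\<rbrakk> \<lbrakk>y, v\<rbrakk> = ?Q"
      by (simp only: skew_biderivation_right[OF \<delta>, of "\<lbrakk>x, u\<rbrakk>" y v]
        skew_biderivation_left[OF \<delta>, of x u v] skew_biderivation_left[OF \<delta>, of x u y]
        bracket_linear(6))
    moreover have "?P - ?Q = (\<lbrakk>\<lbrakk>x, y\<rbrakk>, \<delta> u v\<rbrakk> + \<lbrakk>\<lbrakk>u, v\<rbrakk>, \<delta> x y\<rbrakk>) - (\<lbrakk>\<lbrakk>u, y\<rbrakk>, \<delta> x v\<rbrakk> + \<lbrakk>\<lbrakk>x, v\<rbrakk>, \<delta> u y\<rbrakk>)"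
      unfolding bracket_derivation[of x y "\<delta> u v"] bracket_derivation[of x v "\<delta> u y"]
        bracket_derivation[of u y "\<delta> x v"] bracket_derivation[of u v "\<delta> x y"]
      by (simp add: algebra_simps)
    ultimately have eq: "\<lbrakk>\<lbrakk>x, y\<rbrakk>, \<delta> u v\<rbrakk> + \<lbrakk>\<lbrakk>u, v\<rbrakk>, \<delta> x y\<rbrakk> = \<lbrakk>\<lbrakk>u, y\<rbrakk>, \<delta> x v\<rbrakk> + \<lbrakk>\<lbrakk>x, v\<rbrakk>, \<delta> u y\<rbrakk>"
      by (metis right_minus_eq)
    have \<phi>_eq: "\<phi> x y u v = - (\<lbrakk>\<lbrakk>x, y\<rbrakk>, \<delta> u v\<rbrakk> + \<lbrakk>\<lbrakk>u, v\<rbrakk>, \<delta> x y\<rbrakk>)" for x y u v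
      unfolding \<phi>_def bracket_skew[of "\<delta> x y"] by simp
    show ?thesis by (simp only: \<phi>_eq eq)
  qed
  \<comment> \<open>Applying \<open>sym13\<close> and then \<open>skew12\<close> is a 3-cycle of the
    first three arguments that costs one sign. Three rounds restore the arguments and leave an odd
    number of signs.\<close>
  have "\<phi> x y u v = - \<phi> x y u v"
  proof -
    have "\<phi> x y u v = - \<phi> y u x v" using sym13[of x y u v] skew12[of u y x v] by simp
    also have "\<dots> = \<phi> u x y v" using sym13[of y u x v] skew12[of x u y v] by simp
    also have "\<dots> = - \<phi> x y u v" using sym13[of u x y v] skew12[of y x u v] by simp
    finally show ?thesis .
  qed
  then have "\<phi> x y u v = 0" by (rule eq_neg_self_imp_zero[OF assms(1)])
  then show ?thesis by (simp add: \<phi>_def)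
qed

lemma perfect_skew_biderivation_factors:
  assumes "CHAR('a) \<noteq> 2" "perfect" "centerless" and \<delta>: "skew_biderivation \<delta>"
  obtains \<gamma> where "Vector_Spaces.linear scale scale \<gamma>"
    and "\<And>x y. \<delta> x y = \<gamma> \<lbrakk>x, y\<rbrakk>" and "\<And>x y. \<lbrakk>\<gamma> x, y\<rbrakk> = \<lbrakk>x, \<gamma> y\<rbrakk>"
proof -
  note swap = skew_biderivation_bracket_swap[OF assms(1) \<delta>]
  \<comment> \<open>The value of \<gamma> at z is characterized by how it acts on brackets. The
    condition mentions only z, so no choice of a representation of z as a sum of brackets arises.
    For z = [x,y] the witness is \<delta>(x,y), by \<open>swap\<close>.\<close>
  have "\<exists>w. \<forall>u v. \<lbrakk>w, \<lbrakk>u, v\<rbrakk>\<rbrakk> = \<lbrakk>z, \<delta> u v\<rbrakk>" for z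
    using assms(2)
  proof (induction z rule: perfect_induct)
    case (bracket x y)
    then show ?case using swap by blast
  next
    case (add x y)
    then show ?case by (metis bracket_linear(1))
  next
    case (scale c x)
    then show ?case by (metis bracket_linear(3))
  qed
  then obtain \<gamma> where \<gamma>: "\<And>z u v. \<lbrakk>\<gamma> z, \<lbrakk>u, v\<rbrakk>\<rbrakk> = \<lbrakk>z, \<delta> u v\<rbrakk>" by metis
  note eqI = perfect_centerless_eqI[OF assms(2,3)]
  have lin: "\<gamma> (x + y) = \<gamma> x + \<gamma> y" "\<gamma> (c *s x) = c *s \<gamma> x" for x y c
    by (rule eqI, simp add: \<gamma> bracket_linear)+
  have \<delta>_eq: "\<delta> x y = \<gamma> \<lbrakk>x, y\<rbrakk>" for x y
    by (rule eqI) (simp add: \<gamma> swap)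
  \<comment> \<open>For y = [u,v] this is the defining property of \<gamma>, since \<delta>(u,v) =
    \<gamma>([u,v]).\<close>
  have "\<lbrakk>\<gamma> x, y\<rbrakk> = \<lbrakk>x, \<gamma> y\<rbrakk>" for x y
    using assms(2)
    by (induction y rule: perfect_induct) (simp_all add: \<gamma> \<delta>_eq lin bracket_linear)
  then show thesis using that linearI[OF lin] \<delta>_eq by blast
qed

lemma cyclic_skew_biderivation_eq_zero:
  assumes "CHAR('a) \<noteq> 2" "perfect" and f: "skew_biderivation f"
    and cyclic: "\<And>x y z. \<lbrakk>x, f y z\<rbrakk> = \<lbrakk>y, f z x\<rbrakk>"
  shows "f x y = 0"
proof -
  note bil = bilinear_mapD[OF skew_biderivation_bilinear[OF f]]
  have skew: "\<lbrakk>x, f y z\<rbrakk> = - \<lbrakk>x, f z y\<rbrakk>" for x y z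
    by (metis skew_biderivation_skew[OF f] bracket_linear(8))
  \<comment> \<open>Cyclicity and skewness turn the second term -[y,f(x,z)] of the biderivation rule
    into another copy of the first.\<close>
  have f_bracket: "f \<lbrakk>x, y\<rbrakk> z = \<lbrakk>x, f y z\<rbrakk> + \<lbrakk>x, f y z\<rbrakk>" for x y z
    using skew_biderivation_left[OF f, of x y z] cyclic[of x y z] skew[of y x z] by simp
  define q where "q x y z w = f \<lbrakk>x, y\<rbrakk> \<lbrakk>z, w\<rbrakk>" for x y z w
  have skew12: "q x y z w = - q y x z w" for x y z w
    unfolding q_def bracket_skew[of x y] by (simp add: bil)
  have skew34: "q x y z w = - q x y w z" for x y z w
    unfolding q_def bracket_skew[of z w] by (simp add: bil)
  have swap: "q x y z w = - q z w x y" for x y z w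
    unfolding q_def by (rule skew_biderivation_skew[OF f])
  \<comment> \<open>Both sides are 2[x,-] of an expression in y, z, w; that expression is invariant
    under cycling y, z, w, because f([z,w],y) = 2[z,f(w,y)].\<close>
  have cyc: "q x y z w = q x z w y" for x y z w
  proof -
    have rotate: "f y \<lbrakk>z, w\<rbrakk> = f z \<lbrakk>w, y\<rbrakk>" for y z w
      using skew_biderivation_skew[OF f, of y "\<lbrakk>z, w\<rbrakk>"] skew_biderivation_skew[OF f, of z "\<lbrakk>w, y\<rbrakk>"]
        f_bracket[of z w y] f_bracket[of w y z] cyclic[of z w y] by simp
    show ?thesis unfolding q_def f_bracket rotate[of y] ..
  qed
  \<comment> \<open>The chain is q(x,y,z,w) = q(x,z,w,y) = -q(z,x,w,y) = -q(z,w,y,x) = q(z,w,x,y),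
    which \<open>swap\<close> equates with -q(x,y,z,w).\<close>
  have "q x y z w = - q x y z w" for x y z w
    using cyc[of x y z w] skew12[of x z w y] cyc[of z x w y] skew34[of z w y x] swap[of x y z w]
    by simp
  then have q0: "f \<lbrakk>x, y\<rbrakk> \<lbrakk>z, w\<rbrakk> = 0" for x y z w
    using eq_neg_self_imp_zero[OF assms(1)] unfolding q_def by blast
  have "f \<lbrakk>x, y\<rbrakk> z = 0" for x y z
    using assms(2) by (induction z rule: perfect_induct) (simp_all add: q0 bil)
  with assms(2) show ?thesis
    by (induction x rule: perfect_induct) (simp_all add: bil)
qed

theorem skew_biderivation_centroid:
  assumes "CHAR('a) \<noteq> 2" "perfect" "centerless" and \<delta>: "skew_biderivation \<delta>"
  shows "\<exists>\<gamma>\<in>centroid. \<forall>x y. \<delta> x y = \<gamma> \<lbrakk>x, y\<rbrakk>"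
proof -
  obtain \<gamma> where lin: "Vector_Spaces.linear scale scale \<gamma>"
    and \<delta>_eq: "\<And>x y. \<delta> x y = \<gamma> \<lbrakk>x, y\<rbrakk>" and sym: "\<And>x y. \<lbrakk>\<gamma> x, y\<rbrakk> = \<lbrakk>x, \<gamma> y\<rbrakk>"
    using perfect_skew_biderivation_factors[OF assms] by blast
  interpret \<gamma>: Vector_Spaces.linear scale scale \<gamma> by (rule lin)
  \<comment> \<open>Since \<delta>(x,y) = \<gamma>([x,y]), this measures exactly how far \<gamma> is
    from lying in the centroid.\<close>
  define f where "f x y = \<delta> x y - \<lbrakk>x, \<gamma> y\<rbrakk>" for x y
  note \<delta>_bil = bilinear_mapD[OF skew_biderivation_bilinear[OF \<delta>]]
  have "skew_biderivation f"
    unfolding skew_biderivation_def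
  proof (intro conjI allI)
    show "bilinear_map scale f"
      unfolding bilinear_map_def f_def
      by (intro conjI allI linearI)
        (simp_all add: \<delta>_bil bracket_linear \<gamma>.add \<gamma>.scale scale_right_diff_distrib)
    show "f x y = - f y x" for x y
      using skew_biderivation_skew[OF \<delta>, of x y] bracket_skew[of x "\<gamma> y"] sym[of y x]
      by (simp add: f_def)
    show "f \<lbrakk>x, y\<rbrakk> z = \<lbrakk>x, f y z\<rbrakk> - \<lbrakk>y, f x z\<rbrakk>" for x y z
      using skew_biderivation_left[OF \<delta>, of x y z] bracket_derivation[of x y "\<gamma> z"]
      by (simp add: f_def bracket_linear)
  qed
  moreover have "\<lbrakk>z, f x y\<rbrakk> = \<lbrakk>y, f z x\<rbrakk>" for x y z
  proof -
    \<comment> \<open>Moving \<gamma> across brackets by \<open>sym\<close> and expanding with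
      Jacobi cancels [x,[z,\<gamma>(y)]]. What remains is -[f(z,x),y], that is, [y,f(z,x)].\<close>
    have "\<lbrakk>z, \<gamma> \<lbrakk>x, y\<rbrakk>\<rbrakk> = \<lbrakk>\<gamma> z, \<lbrakk>x, y\<rbrakk>\<rbrakk>" by (simp add: sym)
    also have "\<dots> = \<lbrakk>\<lbrakk>z, \<gamma> x\<rbrakk>, y\<rbrakk> + \<lbrakk>x, \<lbrakk>z, \<gamma> y\<rbrakk>\<rbrakk>"
      using bracket_derivation[of "\<gamma> z" x y] by (simp add: sym)
    finally have "\<lbrakk>z, f x y\<rbrakk> = \<lbrakk>\<lbrakk>z, \<gamma> x\<rbrakk>, y\<rbrakk> - \<lbrakk>\<gamma> \<lbrakk>z, x\<rbrakk>, y\<rbrakk>"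
      using bracket_derivation[of z x "\<gamma> y"]
      by (simp add: f_def \<delta>_eq bracket_linear sym)
    then show ?thesis
      unfolding f_def \<delta>_eq bracket_skew[of _ y] by (simp add: bracket_linear)
  qed
  then have "\<lbrakk>x, f y z\<rbrakk> = \<lbrakk>y, f z x\<rbrakk>" for x y z
    by metis
  ultimately have "f x y = 0" for x y
    using cyclic_skew_biderivation_eq_zero[OF assms(1,2)] by blast
  then have "\<gamma> \<lbrakk>x, y\<rbrakk> = \<lbrakk>x, \<gamma> y\<rbrakk>" for x y
    by (simp add: f_def \<delta>_eq)
  then have "\<gamma> \<in> centroid" using lin by (simp add: centroid_def)
  then show ?thesis using \<delta>_eq by blast
qed

section \<open>Simple Lie algebras are perfect and centerless\<close>

lemma lie_ideal_derived_algebra: "lie_ideal derived_algebra"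
  unfolding lie_ideal_def derived_algebra_def
  by (auto intro: span_base)

lemma lie_ideal_center: "lie_ideal center"
proof -
  have "\<lbrakk>\<lbrakk>x, y\<rbrakk>, z\<rbrakk> = 0" if "y \<in> center" for x y z
  proof -
    have "\<lbrakk>x, y\<rbrakk> = 0"
      using that bracket_skew[of x y] by (simp add: center_def)
    then show ?thesis by (simp add: bracket_linear)
  qed
  then show ?thesis
    unfolding lie_ideal_def subspace_def by (auto simp: center_def bracket_linear)
qed

text \<open>The derived algebra is an ideal, and a nonzero bracket keeps it from being {0}.\<close>

lemma simple_imp_perfect:
  assumes "simple"
  shows "perfect"
proof -
  obtain x y where "\<lbrakk>x, y\<rbrakk> \<noteq> 0" using assms by (auto simp: simple_def)
  moreover have "\<lbrakk>x, y\<rbrakk> \<in> derived_algebra"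
    unfolding derived_algebra_def by (auto intro: span_base)
  ultimately have "derived_algebra \<noteq> {0}" by auto
  then show ?thesis
    using assms lie_ideal_derived_algebra unfolding simple_def perfect_def by blast
qed

text \<open>The center is an ideal, and a nonzero bracket keeps it from being the whole
  algebra.\<close>

lemma simple_imp_centerless:
  assumes "simple"
  shows "centerless"
proof -
  have "center \<noteq> UNIV" using assms unfolding simple_def center_def by blast
  then show ?thesis
    using assms lie_ideal_center unfolding simple_def centerless_def by blast
qed

end

theorem corollary2p4:
  fixes scale :: "'a::field \<Rightarrow> 'b::ab_group_add \<Rightarrow> 'b"
    and bracket :: "'b \<Rightarrow> 'b \<Rightarrow> 'b"
  assumes "CHAR('a) \<noteq> 2"
    and "lie_algebra scale bracket"
  shows "(lie_algebra.perfect scale bracket \<and> lie_algebra.centerless bracket \<longrightarrow>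
            (\<forall>\<delta>. lie_algebra.skew_biderivation scale bracket \<delta> \<longrightarrow>
               (\<exists>\<gamma>\<in>lie_algebra.centroid scale bracket. \<forall>x y. \<delta> x y = \<gamma> (bracket x y)))) \<and>
         (lie_algebra.simple scale bracket \<longrightarrow>
            lie_algebra.perfect scale bracket \<and> lie_algebra.centerless bracket)"
proof -
  interpret lie_algebra scale bracket by (rule assms(2))
  show ?thesis
    using skew_biderivation_centroid[OF assms(1)] simple_imp_perfect simple_imp_centerless
    by blast
qed

end
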